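(* Let $(E,d)$ be a Polish space with $d$ bounded, let $M$ be a measurable space and $(f_\theta)_{\theta\in M}$ a family of Lipschitz functions from $E$ to $E$ such that $l_\theta:=\|f_\theta\|_{\mathrm{Lip}(d)}\le1$ for all $\theta\in M$. Let $(\theta_n)_{n\ge1}$ be an i.i.d. sequence of random variables with values in $M$, and consider the Markov chain $X_{n+1}=f_{\theta_{n+1}}(X_n)$, penalized by $p=e^{-\rho}$, where $\rho:E\to\mathbb{R}_+$ is $d$-Lipschitz. Assume that there exist two constants $c>0$ and $\kappa>0$ such that $$\mathbb{E}_x(Z_n)\ge c\,e^{-\kappa n}\quad\forall n\ge0,\ \forall x\in E.$$ If in addition $q:=\mathbb{P}(l_{\theta_1}=1)<e^{-(\kappa-\inf_E\rho)}$, then condition (A) holds true: there exist $C_A,\gamma_A>0$ and, for all $x,y\in E$, a Markovian coupling $\mathbb{P}_{(x,y)}$ between $\mathbb{P}_x$ and $\mathbb{P}_y$ such that for all $n\in\mathbb{Z}_+$, $$\mathbb{E}_{(x,y)}\left[G^X_n\,d(X_n,Y_n)\right]\le C_Ae^{-\gamma_An}d(x,y).$$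
   Context: $\|f_\theta\|_{\mathrm{Lip}(d)}=\sup_{x\ne y}\frac{d(f_\theta(x),f_\theta(y))}{d(x,y)}$. Implicitly, $(\theta,x)\mapsto f_\theta(x)$ and $\theta\mapsto l_\theta$ are measurable. $\mathbb{P}_x$ is the law of the chain with $X_0=x$ and $\mathbb{E}_x$ its expectation. $Z_n=Z_n(X)=p(X_0)p(X_1)\cdots p(X_{n-1})$, $Z_0=1$. A coupling measure between $\mathbb{P}_x$ and $\mathbb{P}_y$ is a probability measure $\mathbb{P}_{(x,y)}$ on a space carrying $(X_n,Y_n)_{n\ge0}$ such that $(X_n)$ has the law of the chain under $\mathbb{P}_x$ and $(Y_n)$ the law of the chain under $\mathbb{P}_y$. It is Markovian if $(X_n,Y_n)_{n\ge0}$ is Markov with respect to its natural filtration; the couplings are understood as a family $(\mathbb{P}_{(x,y)})_{x,y\in E}$ of laws of a time-homogeneous Markov chain on $E\times E$ started from $(x,y)$. $G^X_n=Z_n(X)/\mathbb{E}_xZ_n$. *)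

theory Defs
  imports "HOL-Probability.Probability"
begin

(* Valued in ennreal so that the supremum is 0 when E is a single point and
   top when g is not Lipschitz. *)
definition Lip_norm :: "('a::metric_space \<Rightarrow> 'a) \<Rightarrow> ennreal" where
  "Lip_norm g = (SUP (x, y) \<in> {(x, y). x \<noteq> y}. ennreal (dist (g x) (g y) / dist x y))"

definition path_space :: "(nat \<Rightarrow> 'b::topological_space) measure" where
  "path_space = Pi\<^sub>M UNIV (\<lambda>_. borel)"

(* The step from n to n + 1 uses theta (n + 1); theta 0 is never used. *)
primrec chain :: "('m \<Rightarrow> 'a \<Rightarrow> 'a) \<Rightarrow> (nat \<Rightarrow> 'w \<Rightarrow> 'm) \<Rightarrow> 'a \<Rightarrow> nat \<Rightarrow> 'w \<Rightarrow> 'a" where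
  "chain f \<theta> x 0 \<omega> = x"
| "chain f \<theta> x (Suc n) \<omega> = f (\<theta> (Suc n) \<omega>) (chain f \<theta> x n \<omega>)"

definition chain_law ::
  "'w measure \<Rightarrow> ('m \<Rightarrow> 'a \<Rightarrow> 'a::topological_space) \<Rightarrow> (nat \<Rightarrow> 'w \<Rightarrow> 'm) \<Rightarrow> 'a \<Rightarrow> (nat \<Rightarrow> 'a) measure"
where
  "chain_law P f \<theta> x = distr P path_space (\<lambda>\<omega> n. chain f \<theta> x n \<omega>)"

definition penal :: "('a \<Rightarrow> real) \<Rightarrow> nat \<Rightarrow> (nat \<Rightarrow> 'a) \<Rightarrow> real" where
  "penal p n X = (\<Prod>k<n. p (X k))"

(* The random variable G_n^X = Z_n(X) / E_x(Z_n), where law x is the law of the chain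
   started from x. *)
definition G_weight ::
  "('a \<Rightarrow> (nat \<Rightarrow> 'a) measure) \<Rightarrow> ('a \<Rightarrow> real) \<Rightarrow> 'a \<Rightarrow> nat \<Rightarrow> (nat \<Rightarrow> 'a) \<Rightarrow> real" where
  "G_weight law p x n X = penal p n X / (\<integral>W. penal p n W \<partial>law x)"

definition coupling ::
  "'w measure \<Rightarrow> ('w \<Rightarrow> nat \<Rightarrow> 'a::topological_space) \<Rightarrow> ('w \<Rightarrow> nat \<Rightarrow> 'a)
     \<Rightarrow> (nat \<Rightarrow> 'a) measure \<Rightarrow> (nat \<Rightarrow> 'a) measure \<Rightarrow> bool"
where
  "coupling N X Y \<mu> \<nu> \<longleftrightarrow>
     prob_space N \<and>
     X \<in> N \<rightarrow>\<^sub>M path_space \<and> distr N path_space X = \<mu> \<and>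
     Y \<in> N \<rightarrow>\<^sub>M path_space \<and> distr N path_space Y = \<nu>"

definition natural_filtration ::
  "'w measure \<Rightarrow> (nat \<Rightarrow> 'w \<Rightarrow> 'b::topological_space) \<Rightarrow> nat \<Rightarrow> 'w measure" where
  "natural_filtration N V n =
     sigma (space N) {V i -` B \<inter> space N | i B. i \<le> n \<and> B \<in> sets borel}"

(* V is, under N, a Markov chain with respect to its natural filtration, with
   transition kernel K at every time step, started from z. *)
definition homogeneous_markov_chain ::
  "'w measure \<Rightarrow> (nat \<Rightarrow> 'w \<Rightarrow> 'b::topological_space) \<Rightarrow> ('b \<Rightarrow> 'b measure) \<Rightarrow> 'b \<Rightarrow> bool"
where
  "homogeneous_markov_chain N V K z \<longleftrightarrow>
     prob_space N \<and>
     K \<in> borel \<rightarrow>\<^sub>M prob_algebra borel \<and>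
     (\<forall>n. V n \<in> N \<rightarrow>\<^sub>M borel) \<and>
     (AE \<omega> in N. V 0 \<omega> = z) \<and>
     (\<forall>n. \<forall>B\<in>sets borel. AE \<omega> in N.
        real_cond_exp N (natural_filtration N V n) (\<lambda>\<omega>. indicator B (V (Suc n) \<omega>)) \<omega>
          = measure (K (V n \<omega>)) B)"

(* Couplings are realised on the path space of E * E, with the coordinate process
   W n = (X n, Y n). One kernel K serves all starting points (x, y): the measures Q (x, y)
   are the laws of a single time-homogeneous Markov chain. *)
definition condition_A ::
  "('a::metric_space \<Rightarrow> (nat \<Rightarrow> 'a) measure) \<Rightarrow> ('a \<Rightarrow> real) \<Rightarrow> bool" where
  "condition_A law p \<longleftrightarrow>
     (\<exists>C>0. \<exists>\<gamma>>0. \<exists>(Q :: 'a \<times> 'a \<Rightarrow> (nat \<Rightarrow> 'a \<times> 'a) measure) K. \<forall>x y.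
        sets (Q (x, y)) = sets path_space \<and>
        coupling (Q (x, y)) (\<lambda>W n. fst (W n)) (\<lambda>W n. snd (W n)) (law x) (law y) \<and>
        homogeneous_markov_chain (Q (x, y)) (\<lambda>n W. W n) K (x, y) \<and>
        (\<forall>n. (\<integral>W. G_weight law p x n (\<lambda>k. fst (W k)) * dist (fst (W n)) (snd (W n)) \<partial>Q (x, y))
               \<le> C * exp (- \<gamma> * real n) * dist x y))"

end

theory Submission
  imports Defs
begin

text \<open>
  Run both chains with the same maps. Then \<open>d(X\<^sub>n, Y\<^sub>n) \<le> L\<^sub>n d(x, y)\<close> with
  \<open>L\<^sub>n = l\<^bsub>\<theta>\<^sub>1\<^esub> \<cdots> l\<^bsub>\<theta>\<^sub>n\<^esub>\<close>. As \<open>l \<le> 1\<close>, the moments \<open>E(l\<^sup>a)\<close> decrease to \<open>q\<close> when \<open>a\<close> grows, so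
  \<open>e\<^bsup>\<kappa> - inf \<rho>\<^esup> E(l\<^sup>a) \<le> r\<^sup>a\<close> for some \<open>a \<ge> 1\<close> and \<open>r < 1\<close>. Since \<open>Z\<^sub>n \<le> e\<^bsup>- n inf \<rho>\<^esup>\<close> and
  \<open>E Z\<^sub>n \<ge> c e\<^bsup>- \<kappa> n\<^esup>\<close>, independence yields \<open>E(G\<^sub>n L\<^sub>n\<^sup>a) \<le> r\<^bsup>a n\<^esup> / c\<close>, and
  \<open>L\<^sub>n \<le> r\<^sup>n + L\<^sub>n\<^sup>a / r\<^bsup>n (a - 1)\<^esup>\<close> turns this into \<open>E(G\<^sub>n L\<^sub>n) \<le> (1 + 1 / c) r\<^sup>n\<close>.
\<close>

section \<open>Path space and measurability of the chain\<close>

lemma space_path_space [simp]: "space path_space = UNIV"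
  by (simp add: path_space_def space_PiM)

lemma measurable_path_space_component [measurable]: "(\<lambda>W. W n) \<in> path_space \<rightarrow>\<^sub>M borel"
  unfolding path_space_def by simp

lemma measurable_path_spaceI:
  assumes "\<And>n. (\<lambda>\<omega>. V \<omega> n) \<in> N \<rightarrow>\<^sub>M borel"
  shows "V \<in> N \<rightarrow>\<^sub>M path_space"
  unfolding path_space_def
  using assms by (intro measurable_PiM_single') auto

text \<open>The driving variables are required to be measurable only for indices from 1 to
  \<open>n\<close>, so that the chain can also be run on the finite product over
  \<open>{1..n}\<close>, with the coordinates as driving variables.\<close>

lemma measurable_chain:
  fixes F :: "'m \<Rightarrow> 'b \<Rightarrow> 'b::topological_space"
  assumes F: "(\<lambda>(t, x). F t x) \<in> M \<Otimes>\<^sub>M borel \<rightarrow>\<^sub>M borel"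
    and \<theta>: "\<And>i. 1 \<le> i \<Longrightarrow> i \<le> n \<Longrightarrow> \<theta> i \<in> N \<rightarrow>\<^sub>M M"
  shows "chain F \<theta> x n \<in> N \<rightarrow>\<^sub>M borel"
  using \<theta>
proof (induction n)
  case 0
  then show ?case by (simp cong: measurable_cong)
next
  case (Suc n)
  have [measurable]: "chain F \<theta> x n \<in> N \<rightarrow>\<^sub>M borel" "\<theta> (Suc n) \<in> N \<rightarrow>\<^sub>M M"
    using Suc by auto
  have "(\<lambda>\<omega>. case (\<theta> (Suc n) \<omega>, chain F \<theta> x n \<omega>) of (t, x) \<Rightarrow> F t x) \<in> N \<rightarrow>\<^sub>M borel"
    by (rule measurable_compose[OF _ F]) measurable
  then show ?case by (simp cong: measurable_cong)
qed

lemma measurable_chain_path: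
  fixes F :: "'m \<Rightarrow> 'b \<Rightarrow> 'b::topological_space"
  assumes "(\<lambda>(t, x). F t x) \<in> M \<Otimes>\<^sub>M borel \<rightarrow>\<^sub>M borel"
    and "\<And>i. 1 \<le> i \<Longrightarrow> \<theta> i \<in> N \<rightarrow>\<^sub>M M"
  shows "(\<lambda>\<omega> n. chain F \<theta> x n \<omega>) \<in> N \<rightarrow>\<^sub>M path_space"
  using assms by (intro measurable_path_spaceI measurable_chain)

section \<open>The Markov property of a chain driven by i.i.d. maps\<close>

text \<open>Steps up to time \<open>n\<close> read only \<open>\<theta> 1\<close> to
  \<open>\<theta> n\<close>, so the past is a deterministic function of a finite tuple. The tuple is
  a restriction because independence of disjoint blocks is stated for restricted families.\<close>

lemma chain_restrict:
  assumes "k \<le> n"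
  shows "chain F (\<lambda>i s. s i) x k (restrict (\<lambda>i. \<theta> i \<omega>) {1..n}) = chain F \<theta> x k \<omega>"
  using assms by (induction k) auto

text \<open>The generators inspect only times \<open>i \<le> n\<close>, where
  \<open>min i n = i\<close>, and complements and countable unions keep this invariance. Hence a
  past event is a function of the path frozen at time \<open>n\<close>.\<close>

lemma natural_filtration_stopped:
  assumes "A \<in> sets (natural_filtration N (\<lambda>n W. W n) n)" and "space N = UNIV"
  shows "W \<in> A \<longleftrightarrow> (\<lambda>k. W (min k n)) \<in> A"
proof -
  have "A \<in> sigma_sets UNIV {(\<lambda>W. W i) -` B | i B. i \<le> n \<and> B \<in> sets borel}"
    using assms by (simp add: natural_filtration_def sets_measure_of_conv)
  then show ?thesis
    by (induction arbitrary: W) (auto simp: min_def)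
qed

lemma subalgebra_natural_filtration:
  assumes "\<And>n. V n \<in> N \<rightarrow>\<^sub>M borel"
  shows "subalgebra N (natural_filtration N V n)"
  unfolding subalgebra_def natural_filtration_def
  using assms by (auto simp: space_measure_of_conv sets_measure_of_conv
      intro!: sets.sigma_sets_subset measurable_sets)

lemma measurable_natural_filtration:
  "V n \<in> natural_filtration N V n \<rightarrow>\<^sub>M borel"
  unfolding natural_filtration_def
  by (rule measurableI) (auto simp: space_measure_of_conv sets_measure_of_conv intro!: sigma_sets.Basic)

text \<open>The variable \<open>\<theta> (Suc n)\<close> is independent of the past and has law
  \<open>\<mu>\<close>, so at current state \<open>x\<close> the next state has as conditional law
  the image of \<open>\<mu>\<close> under \<open>\<lambda>t. F t x\<close>. The general state space
  allows pairs of chains.\<close>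

lemma homogeneous_markov_chain_chain_law:
  fixes F :: "'m \<Rightarrow> 'b \<Rightarrow> 'b::t1_space"
  assumes P: "prob_space P"
    and F: "(\<lambda>(t, x). F t x) \<in> M \<Otimes>\<^sub>M borel \<rightarrow>\<^sub>M borel"
    and indep: "prob_space.indep_vars P (\<lambda>_. M) \<theta> {1..}"
    and iid: "\<And>n. n \<ge> 1 \<Longrightarrow> distr P M (\<theta> n) = \<mu>"
  shows "homogeneous_markov_chain (chain_law P F \<theta> z) (\<lambda>n W. W n)
           (\<lambda>x. distr \<mu> borel (\<lambda>t. F t x)) z"
proof -
  interpret P: prob_space P by fact
  define N where "N = chain_law P F \<theta> z"
  define K where "K x = distr \<mu> borel (\<lambda>t. F t x)" for x
  have \<theta>[measurable]: "\<theta> i \<in> P \<rightarrow>\<^sub>M M" if "1 \<le> i" for i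
    using indep that by (auto simp: P.indep_vars_def)
  have path[measurable]: "(\<lambda>\<omega> n. chain F \<theta> z n \<omega>) \<in> P \<rightarrow>\<^sub>M path_space"
    by (rule measurable_chain_path[OF F \<theta>])
  have \<mu>: "prob_space \<mu>" and sets_\<mu>[measurable_cong]: "sets \<mu> = sets M"
    using iid[of 1] P.prob_space_distr[OF \<theta>, of 1] by auto
  interpret \<mu>: prob_space \<mu> by fact
  have sets_N[measurable_cong]: "sets N = sets path_space" and space_N: "space N = UNIV"
    by (simp_all add: N_def chain_law_def)
  interpret N: prob_space N
    unfolding N_def chain_law_def by (rule P.prob_space_distr) (rule path)
  have F_swap: "(\<lambda>(x, t). F t x) \<in> borel \<Otimes>\<^sub>M \<mu> \<rightarrow>\<^sub>M borel"
    using measurable_compose[OF measurable_pair_swap' F]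
    by (simp add: case_prod_beta' cong: measurable_cong measurable_cong_sets[OF sets_pair_measure_cong[OF refl sets_\<mu>] refl])
  have F_t[measurable]: "(\<lambda>t. F t x) \<in> \<mu> \<rightarrow>\<^sub>M borel" for x
    using measurable_compose[OF _ F_swap, of "\<lambda>t. (x, t)" \<mu>] by simp
  have K[measurable]: "K \<in> borel \<rightarrow>\<^sub>M prob_algebra borel"
    unfolding K_def using F_swap
    by (intro measurable_distr_prob_space2[where M=\<mu>])
       (auto simp: space_prob_algebra \<mu>)
  have KB[measurable]: "(\<lambda>x. measure (K x) B) \<in> borel_measurable borel" if "B \<in> sets borel" for B
    using measurable_compose[OF K measurable_measure_prob_algebra[OF that]] .
  have K_int: "measure (K x) B = (\<integral>t. indicator B (F t x) \<partial>\<mu>)" if [measurable]: "B \<in> sets borel" for x B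
  proof -
    have "measure (K x) B = (\<integral>w. indicator B w \<partial>K x)"
      using that by (simp add: K_def)
    also have "\<dots> = (\<integral>t. indicator B (F t x) \<partial>\<mu>)"
      unfolding K_def by (subst integral_distr[OF F_t]) auto
    finally show ?thesis .
  qed
  have K1: "measure (K x) B \<le> 1" for x B
    unfolding K_def by (intro prob_space.prob_le_1 \<mu>.prob_space_distr F_t)
  have markov: "AE W in N. real_cond_exp N (natural_filtration N (\<lambda>n W. W n) n)
      (\<lambda>W. indicator B (W (Suc n))) W = measure (K (W n)) B"
    if B[measurable]: "B \<in> sets borel" for n B
  proof -
    define G where "G = natural_filtration N (\<lambda>n W. W n) n"
    have sub: "subalgebra N G"
      unfolding G_def by (rule subalgebra_natural_filtration) simp
    interpret finite_measure_subalgebra N G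
      by standard (rule sub)
    \<comment> \<open>Running the chain on the coordinates makes the state at time
      \<open>k \<le> n\<close> equal to \<open>?g k (?S \<omega>)\<close>.\<close>
    let ?g = "chain F (\<lambda>i s. s i) z"
    let ?S = "\<lambda>\<omega>. restrict (\<lambda>i. \<theta> i \<omega>) {1..n}"
    let ?SM = "PiM {1..n} (\<lambda>_. M)"
    have g[measurable]: "?g k \<in> ?SM \<rightarrow>\<^sub>M borel" if "k \<le> n" for k
      using that by (intro measurable_chain[OF F]) auto
    \<comment> \<open>Freezing at time \<open>n\<close> keeps every coordinate of the path
      measurable over the finite tuple.\<close>
    have H[measurable]: "(\<lambda>s k. ?g (min k n) s) \<in> ?SM \<rightarrow>\<^sub>M path_space"
      by (intro measurable_path_spaceI g) simp
    have S[measurable]: "?S \<in> P \<rightarrow>\<^sub>M ?SM"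
      by (rule measurable_restrict) (use \<theta> in auto)
    have joint: "distr P ?SM ?S \<Otimes>\<^sub>M \<mu> = distr P (?SM \<Otimes>\<^sub>M M) (\<lambda>\<omega>. (?S \<omega>, \<theta> (Suc n) \<omega>))"
    proof -
      \<comment> \<open>Block independence compares tuples, so \<open>\<theta> (Suc n)\<close> first
        enters as a tuple over a singleton and is then projected to its coordinate.\<close>
      let ?T = "\<lambda>\<omega>. restrict (\<lambda>i. \<theta> i \<omega>) {Suc n}"
      let ?TM = "PiM {Suc n} (\<lambda>_. M)"
      have T[measurable]: "?T \<in> P \<rightarrow>\<^sub>M ?TM"
        by (rule measurable_restrict) (use \<theta> in auto)
      have next_step: "\<mu> = distr (distr P ?TM ?T) M (\<lambda>s. s (Suc n))"
        using iid[of "Suc n"] by (subst distr_distr) (auto simp: comp_def)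
      have "P.indep_var ?SM ?S ?TM ?T"
        by (rule P.indep_var_restrict[OF indep]) auto
      then have ST: "distr P ?SM ?S \<Otimes>\<^sub>M distr P ?TM ?T = distr P (?SM \<Otimes>\<^sub>M ?TM) (\<lambda>\<omega>. (?S \<omega>, ?T \<omega>))"
        by (simp add: P.indep_var_distribution_eq)
      have "distr P ?SM ?S \<Otimes>\<^sub>M \<mu>
          = distr (distr P ?SM ?S) ?SM (\<lambda>s. s) \<Otimes>\<^sub>M distr (distr P ?TM ?T) M (\<lambda>s. s (Suc n))"
        by (simp add: next_step distr_id2)
      also have "\<dots> = distr (distr P ?SM ?S \<Otimes>\<^sub>M distr P ?TM ?T) (?SM \<Otimes>\<^sub>M M) (\<lambda>(s, t). (s, t (Suc n)))"
        using \<mu>.sigma_finite_measure_axioms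
        by (intro pair_measure_distr) (auto simp: next_step[symmetric])
      also have "\<dots> = distr P (?SM \<Otimes>\<^sub>M M) (\<lambda>\<omega>. (?S \<omega>, \<theta> (Suc n) \<omega>))"
        unfolding ST by (subst distr_distr) (auto simp: comp_def)
      finally show ?thesis .
    qed
    interpret S: prob_space "distr P ?SM ?S" by (rule P.prob_space_distr[OF S])
    interpret S\<mu>: pair_prob_space "distr P ?SM ?S" \<mu> ..
    show ?thesis
      unfolding G_def[symmetric]
    proof (rule real_cond_exp_charact)
      fix A assume A: "A \<in> sets G"
      then have [measurable]: "A \<in> sets path_space"
        using sub sets_N by (auto simp: subalgebra_def)
      let ?h = "\<lambda>s. indicator A (\<lambda>k. ?g (min k n) s) :: real"
      let ?u = "\<lambda>(s, t). ?h s * indicator B (F t (?g n s)) :: real"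
      \<comment> \<open>An event of the past is decided by \<open>\<theta>\<^sub>1, \<dots>, \<theta>\<^sub>n\<close>, hence independent of \<open>\<theta>\<^sub>n\<^sub>+\<^sub>1\<close>.\<close>
      have past: "indicator A (\<lambda>k. chain F \<theta> z k \<omega>) = ?h (?S \<omega>)" for \<omega>
        using natural_filtration_stopped[OF A[unfolded G_def] space_N, of "\<lambda>k. chain F \<theta> z k \<omega>"]
        by (simp add: indicator_def chain_restrict del: One_nat_def)
      have Fg: "(\<lambda>(s, t). F t (?g n s)) \<in> ?SM \<Otimes>\<^sub>M M \<rightarrow>\<^sub>M borel"
      proof -
        have "(\<lambda>w. (snd w, ?g n (fst w))) \<in> ?SM \<Otimes>\<^sub>M M \<rightarrow>\<^sub>M M \<Otimes>\<^sub>M borel"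
          by (intro measurable_Pair measurable_snd measurable_compose[OF measurable_fst g]) simp
        from measurable_compose[OF this F] show ?thesis
          by (simp add: case_prod_beta')
      qed
      have h[measurable]: "?h \<in> borel_measurable ?SM"
        by (rule measurable_compose[OF H borel_measurable_indicator]) simp
      have u[measurable]: "?u \<in> borel_measurable (?SM \<Otimes>\<^sub>M M)"
        unfolding case_prod_beta'
        by (intro borel_measurable_times measurable_compose[OF measurable_fst h])
           (use measurable_compose[OF Fg borel_measurable_indicator[OF B]] in \<open>simp add: case_prod_beta'\<close>)
      have u': "?u \<in> borel_measurable (distr P ?SM ?S \<Otimes>\<^sub>M \<mu>)"
        unfolding joint using u by simp
      have "(\<integral>W\<in>A. (indicator B (W (Suc n)) :: real) \<partial>N)
          = (\<integral>\<omega>. indicator A (\<lambda>k. chain F \<theta> z k \<omega>) * indicator B (chain F \<theta> z (Suc n) \<omega>) \<partial>P)"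
        unfolding set_lebesgue_integral_def N_def chain_law_def by (subst integral_distr) auto
      also have "\<dots> = (\<integral>\<omega>. ?u (?S \<omega>, \<theta> (Suc n) \<omega>) \<partial>P)"
        by (simp add: past chain_restrict del: One_nat_def)
      also have "\<dots> = (\<integral>w. ?u w \<partial>(distr P ?SM ?S \<Otimes>\<^sub>M \<mu>))"
        unfolding joint by (subst integral_distr[OF _ u]) (auto simp del: One_nat_def)
      \<comment> \<open>Fubini under the product law averages out the fresh variable; the inner
        integral is the kernel by \<open>K_int\<close>.\<close>
      also have "\<dots> = (\<integral>s. \<integral>t. ?u (s, t) \<partial>\<mu> \<partial>distr P ?SM ?S)"
        by (intro S\<mu>.integral_fst'[symmetric] S\<mu>.P.integrable_const_bound[OF _ u', where B=1] AE_I2)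
           (simp add: case_prod_beta' indicator_def)
      also have "\<dots> = (\<integral>s. ?h s * measure (K (?g n s)) B \<partial>distr P ?SM ?S)"
        by (simp add: K_int)
      also have "\<dots> = (\<integral>\<omega>. ?h (?S \<omega>) * measure (K (?g n (?S \<omega>))) B \<partial>P)"
        by (rule integral_distr[OF S borel_measurable_times[OF h measurable_compose[OF g[OF order_refl] KB[OF B]]]])
      also have "\<dots> = (\<integral>\<omega>. indicator A (\<lambda>k. chain F \<theta> z k \<omega>) * measure (K (chain F \<theta> z n \<omega>)) B \<partial>P)"
        by (simp add: past chain_restrict del: One_nat_def)
      also have "\<dots> = (\<integral>W\<in>A. measure (K (W n)) B \<partial>N)"
        unfolding set_lebesgue_integral_def N_def chain_law_def by (subst integral_distr) auto
      finally show "(\<integral>W\<in>A. (indicator B (W (Suc n)) :: real) \<partial>N) = (\<integral>W\<in>A. measure (K (W n)) B \<partial>N)" .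
    next
      show "integrable N (\<lambda>W. indicator B (W (Suc n)) :: real)"
        by (rule N.integrable_const_bound[where B=1]) auto
      show "integrable N (\<lambda>W. measure (K (W n)) B)"
        by (rule N.integrable_const_bound[where B=1]) (auto simp: K1)
      have "(\<lambda>W. W n) \<in> G \<rightarrow>\<^sub>M borel"
        unfolding G_def by (rule measurable_natural_filtration)
      then show "(\<lambda>W. measure (K (W n)) B) \<in> borel_measurable G"
        by measurable
    qed
  qed
  \<comment> \<open>Singletons are closed in a T1 space, which makes the event
    \<open>W 0 = z\<close> measurable.\<close>
  have "AE W in N. W 0 = z"
    using measurable_sets[OF measurable_path_space_component[of 0], of "{z}"]
    unfolding N_def chain_law_def by (subst AE_distr_iff) (auto simp: vimage_def)
  then show ?thesis
    unfolding homogeneous_markov_chain_def N_def[symmetric] K_def[symmetric]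
    using markov K N.prob_space_axioms by auto
qed

section \<open>Contraction of two chains driven by the same maps\<close>

text \<open>The synchronous coupling is itself a chain driven by \<open>\<theta>\<close>, with
  product maps. Hence the Markov property applies to it, and its coordinates are the two original
  chains.\<close>

lemma chain_map_prod:
  "chain (\<lambda>t. map_prod (f t) (g t)) \<theta> (x, y) n \<omega> = (chain f \<theta> x n \<omega>, chain g \<theta> y n \<omega>)"
  by (induction n) auto

text \<open>Distinct points contribute their quotient to the supremum; equal points give 0 on both
  sides. Finiteness matters because \<open>enn2real\<close> sends infinity to 0.\<close>

lemma dist_le_Lip_norm:
  assumes "Lip_norm g \<noteq> \<top>"
  shows "dist (g x) (g y) \<le> enn2real (Lip_norm g) * dist x y"
proof (cases "x = y")
  case False
  then have "ennreal (dist (g x) (g y) / dist x y) \<le> Lip_norm g"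
    unfolding Lip_norm_def by (intro SUP_upper2[of "(x, y)"]) auto
  then have "dist (g x) (g y) / dist x y \<le> enn2real (Lip_norm g)"
    using assms by (simp add: ennreal_enn2real_if flip: ennreal_le_iff)
  then show ?thesis
    using False by (simp add: field_simps)
qed simp

lemma dist_chain_le:
  fixes f :: "'m \<Rightarrow> 'a \<Rightarrow> 'a::metric_space"
  assumes "\<And>i. 1 \<le> i \<Longrightarrow> Lip_norm (f (\<theta> i \<omega>)) \<noteq> \<top>"
  shows "dist (chain f \<theta> x n \<omega>) (chain f \<theta> y n \<omega>)
       \<le> (\<Prod>i\<in>{1..n}. enn2real (Lip_norm (f (\<theta> i \<omega>)))) * dist x y"
proof (induction n)
  case (Suc n)
  let ?l = "enn2real (Lip_norm (f (\<theta> (Suc n) \<omega>)))"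
  have "dist (chain f \<theta> x (Suc n) \<omega>) (chain f \<theta> y (Suc n) \<omega>)
      \<le> ?l * dist (chain f \<theta> x n \<omega>) (chain f \<theta> y n \<omega>)"
    using dist_le_Lip_norm[OF assms, of "Suc n"] by simp
  also have "\<dots> \<le> ?l * ((\<Prod>i\<in>{1..n}. enn2real (Lip_norm (f (\<theta> i \<omega>)))) * dist x y)"
    by (intro mult_left_mono Suc) auto
  finally show ?case
    by (simp add: mult_ac)
qed simp

section \<open>Moments, interpolation and bounds on the penalization\<close>

text \<open>Pointwise, \<open>l x ^ a\<close> tends to the indicator of \<open>l x = 1\<close>, and
  the constant 1 dominates.\<close>

lemma (in prob_space) tendsto_moments:
  assumes [measurable]: "l \<in> borel_measurable M"
    and l: "\<And>x. x \<in> space M \<Longrightarrow> 0 \<le> l x" "\<And>x. x \<in> space M \<Longrightarrow> l x \<le> 1"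
  shows "(\<lambda>a. \<integral>x. l x ^ a \<partial>M) \<longlonglongrightarrow> measure M {x \<in> space M. l x = (1::real)}"
proof -
  have "(\<lambda>a. \<integral>x. l x ^ a \<partial>M) \<longlonglongrightarrow> (\<integral>x. indicator {x \<in> space M. l x = 1} x \<partial>M)"
  proof (rule integral_dominated_convergence[where w="\<lambda>_. 1"])
    show "AE x in M. (\<lambda>a. l x ^ a) \<longlonglongrightarrow> indicator {x \<in> space M. l x = 1} x"
    proof (rule AE_I2)
      fix x assume "x \<in> space M"
      then show "(\<lambda>a. l x ^ a) \<longlonglongrightarrow> indicator {x \<in> space M. l x = 1} x"
        using l[of x] LIMSEQ_realpow_zero[of "l x"] by (cases "l x = 1") auto
    qed
    show "AE x in M. norm (l x ^ a) \<le> 1" for a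
      using l by (intro AE_I2) (auto intro: power_le_one)
  qed auto
  then show ?thesis
    by simp
qed

text \<open>If \<open>t > s\<close>, then \<open>(t / s) ^ b \<ge> 1\<close>. With
  \<open>s = r ^ n\<close> this replaces the product of Lipschitz constants by a small error plus a
  high power, whose mean is under control.\<close>

lemma le_add_power_div:
  fixes s t :: real
  assumes "0 < s" "0 \<le> t"
  shows "t \<le> s + t ^ Suc b / s ^ b"
proof (cases "t \<le> s")
  case True
  then show ?thesis using assms by (simp add: add_increasing2)
next
  case False
  then have "s ^ b * t \<le> t ^ b * t"
    using assms by (intro mult_right_mono power_mono) auto
  then have "t \<le> t ^ Suc b / s ^ b"
    using assms by (simp add: field_simps)
  then show ?thesis using assms by linarith
qed

lemma penal_exp_le:
  assumes "\<And>x. m \<le> \<rho> x"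
  shows "penal (\<lambda>z. exp (- \<rho> z)) n X \<le> exp (- m * real n)"
proof -
  have "penal (\<lambda>z. exp (- \<rho> z)) n X \<le> (\<Prod>k<n. exp (- m))"
    unfolding penal_def using assms by (intro prod_mono) auto
  then show ?thesis by (simp add: exp_of_nat_mult[symmetric] mult.commute)
qed

lemma measurable_penal:
  assumes [measurable]: "p \<in> borel_measurable borel"
  shows "penal p n \<in> borel_measurable path_space"
  unfolding penal_def[abs_def] by measurable

section \<open>Condition (A) for the penalized chain\<close>

theorem proposition3p3:
  fixes P :: "'w measure"
    and M :: "'m measure"
    and f :: "'m \<Rightarrow> 'a::polish_space \<Rightarrow> 'a"
    and \<theta> :: "nat \<Rightarrow> 'w \<Rightarrow> 'm"
    and \<rho> :: "'a \<Rightarrow> real"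
    and c \<kappa> :: real
  assumes "bounded (UNIV :: 'a set)"
    and "(\<lambda>(t, x). f t x) \<in> M \<Otimes>\<^sub>M borel \<rightarrow>\<^sub>M borel"
    and "(\<lambda>t. Lip_norm (f t)) \<in> borel_measurable M"
    and "\<And>t. t \<in> space M \<Longrightarrow> \<exists>L. L-lipschitz_on UNIV (f t)"
    and "\<And>t. t \<in> space M \<Longrightarrow> Lip_norm (f t) \<le> 1"
    and "prob_space P"
    and "prob_space.indep_vars P (\<lambda>_. M) \<theta> {1..}"
    and "\<And>n. n \<ge> 1 \<Longrightarrow> distr P M (\<theta> n) = distr P M (\<theta> 1)"
    and "\<And>x. \<rho> x \<ge> 0"
    and "\<exists>L. L-lipschitz_on UNIV \<rho>"
    and "c > 0" and "\<kappa> > 0"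
    and "\<And>n x. (\<integral>W. penal (\<lambda>z. exp (- \<rho> z)) n W \<partial>chain_law P f \<theta> x) \<ge> c * exp (- \<kappa> * real n)"
    and "measure P {\<omega> \<in> space P. Lip_norm (f (\<theta> 1 \<omega>)) = 1} < exp (- (\<kappa> - (INF x. \<rho> x)))"
  shows "condition_A (chain_law P f \<theta>) (\<lambda>z. exp (- \<rho> z))"
proof -
  interpret P: prob_space P by fact
  define l where "l t = enn2real (Lip_norm (f t))" for t
  define m where "m = (INF x. \<rho> x)"
  define p where "p = (\<lambda>z. exp (- \<rho> z))"
  define Q where "Q = chain_law P (\<lambda>t. map_prod (f t) (f t)) \<theta>"
  define D where "D x n = (\<integral>W. penal p n W \<partial>chain_law P f \<theta> x)" for x n
  note f = assms(2) and indep = assms(7)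
  have \<theta>[measurable]: "\<theta> i \<in> P \<rightarrow>\<^sub>M M" if "1 \<le> i" for i
    using indep that by (auto simp: P.indep_vars_def)
  have lm[measurable]: "l \<in> borel_measurable M"
    unfolding l_def using assms(3) by measurable
  have fin: "Lip_norm (f t) \<noteq> \<top>" if "t \<in> space M" for t
    using assms(5)[OF that] by (auto simp: top_unique)
  have l0: "0 \<le> l t" for t
    by (simp add: l_def)
  have l1: "l t \<le> 1" if "t \<in> space M" for t
    unfolding l_def using assms(5)[OF that] by (intro enn2real_leI) auto
  have \<theta>_space: "\<theta> i \<omega> \<in> space M" if "1 \<le> i" "\<omega> \<in> space P" for i \<omega>
    using measurable_space[OF \<theta>] that by auto
  \<comment> \<open>An infimum of reals is a lower bound only for a set bounded below; nonnegativity
    of \<open>\<rho>\<close> provides this.\<close>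
  have m: "m \<le> \<rho> x" for x
    unfolding m_def using assms(9) by (intro cINF_lower bdd_belowI2[of _ 0]) auto
  have [measurable]: "\<rho> \<in> borel_measurable borel"
    using assms(10) by (blast intro: borel_measurable_continuous_onI lipschitz_on_continuous_on)
  have [measurable]: "p \<in> borel_measurable borel"
    unfolding p_def by measurable
  note [measurable] = measurable_penal[of p]
  have penal0: "0 \<le> penal p n X" for n X
    by (auto simp: penal_def p_def intro: prod_nonneg)
  have penal_le: "penal p n X \<le> exp (- m * real n)" for n X
    unfolding p_def by (rule penal_exp_le[OF m])

  \<comment> \<open>The synchronous coupling, its kernel and its marginals\<close>
  have ff: "(\<lambda>(t, z). map_prod (f t) (f t) z) \<in> M \<Otimes>\<^sub>M borel \<rightarrow>\<^sub>M borel"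
  proof -
    have "(\<lambda>w. f (fst w) (fst (snd w))) \<in> M \<Otimes>\<^sub>M (borel \<Otimes>\<^sub>M borel) \<rightarrow>\<^sub>M borel"
      "(\<lambda>w. f (fst w) (snd (snd w))) \<in> M \<Otimes>\<^sub>M (borel \<Otimes>\<^sub>M borel) \<rightarrow>\<^sub>M borel"
      using measurable_compose[OF _ f, of "\<lambda>w. (fst w, fst (snd w))" "M \<Otimes>\<^sub>M (borel \<Otimes>\<^sub>M borel)"]
        measurable_compose[OF _ f, of "\<lambda>w. (fst w, snd (snd w))" "M \<Otimes>\<^sub>M (borel \<Otimes>\<^sub>M borel)"]
      by simp_all
    then have "(\<lambda>w. (f (fst w) (fst (snd w)), f (fst w) (snd (snd w))))
        \<in> M \<Otimes>\<^sub>M (borel \<Otimes>\<^sub>M borel) \<rightarrow>\<^sub>M borel \<Otimes>\<^sub>M borel"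
      by (rule measurable_Pair)
    then show ?thesis
      by (simp add: borel_prod map_prod_def case_prod_beta')
  qed
  have path[measurable]: "(\<lambda>\<omega> n. chain f \<theta> x n \<omega>) \<in> P \<rightarrow>\<^sub>M path_space" for x
    by (rule measurable_chain_path[OF f \<theta>])
  have path2[measurable]: "(\<lambda>\<omega> n. chain (\<lambda>t. map_prod (f t) (f t)) \<theta> z n \<omega>) \<in> P \<rightarrow>\<^sub>M path_space" for z
    by (rule measurable_chain_path[OF ff \<theta>])
  have fst_path[measurable]: "(\<lambda>W n. fst (W n)) \<in> path_space \<rightarrow>\<^sub>M (path_space :: (nat \<Rightarrow> 'a) measure)"
    and snd_path[measurable]: "(\<lambda>W n. snd (W n)) \<in> path_space \<rightarrow>\<^sub>M (path_space :: (nat \<Rightarrow> 'a) measure)"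
    by (auto intro!: measurable_path_spaceI measurable_compose[OF measurable_path_space_component]
        borel_measurable_continuous_onI continuous_intros)
  \<comment> \<open>The kernel does not involve \<open>z\<close>, so one \<open>K\<close> serves all
    starting pairs, as \<open>condition_A\<close> demands.\<close>
  have markov: "homogeneous_markov_chain (Q z) (\<lambda>n W. W n)
      (\<lambda>x. distr (distr P M (\<theta> 1)) borel (\<lambda>t. map_prod (f t) (f t) x)) z" for z
    unfolding Q_def by (rule homogeneous_markov_chain_chain_law[OF assms(6) ff indep assms(8)])
  have sets_Q: "sets (Q z) = sets path_space" for z
    by (simp add: Q_def chain_law_def)
  have coupling: "coupling (Q (x, y)) (\<lambda>W n. fst (W n)) (\<lambda>W n. snd (W n))
      (chain_law P f \<theta> x) (chain_law P f \<theta> y)" for x y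
  proof -
    have "distr (Q (x, y)) path_space (\<lambda>W n. fst (W n)) = chain_law P f \<theta> x"
      "distr (Q (x, y)) path_space (\<lambda>W n. snd (W n)) = chain_law P f \<theta> y"
      unfolding Q_def chain_law_def distr_distr[OF fst_path path2] distr_distr[OF snd_path path2]
      by (simp_all add: comp_def chain_map_prod)
    moreover have "prob_space (Q (x, y))"
      using markov by (simp add: homogeneous_markov_chain_def)
    ultimately show ?thesis
      unfolding coupling_def using fst_path snd_path
      by (simp add: measurable_cong_sets[OF sets_Q refl])
  qed

  \<comment> \<open>Choice of the exponent and of the contraction rate\<close>
  obtain b r where r: "0 < r" "r < 1"
    and rb: "exp (\<kappa> - m) * (\<integral>\<omega>. l (\<theta> 1 \<omega>) ^ Suc b \<partial>P) \<le> r ^ Suc b"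
  proof -
    have "enn2real u = 1 \<longleftrightarrow> u = 1" if "u \<noteq> \<top>" for u
      using that by (cases u) auto
    then have "{\<omega> \<in> space P. Lip_norm (f (\<theta> 1 \<omega>)) = 1} = {\<omega> \<in> space P. l (\<theta> 1 \<omega>) = 1}"
      using fin[OF \<theta>_space] by (auto simp: l_def)
    then have "measure P {\<omega> \<in> space P. l (\<theta> 1 \<omega>) = 1} < exp (- (\<kappa> - m))"
      using assms(14) by (simp add: m_def)
    moreover have "(\<lambda>a. \<integral>\<omega>. l (\<theta> 1 \<omega>) ^ a \<partial>P) \<longlonglongrightarrow> measure P {\<omega> \<in> space P. l (\<theta> 1 \<omega>) = 1}"
      using l0 l1[OF \<theta>_space] by (intro P.tendsto_moments) auto
    ultimately have "\<forall>\<^sub>F a in sequentially. (\<integral>\<omega>. l (\<theta> 1 \<omega>) ^ a \<partial>P) < exp (- (\<kappa> - m))"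
      by (intro order_tendstoD(2))
    \<comment> \<open>A successor exponent gives the root below a positive order and has the form
      \<open>Suc b\<close> of \<open>le_add_power_div\<close>.\<close>
    then obtain b where "(\<integral>\<omega>. l (\<theta> 1 \<omega>) ^ Suc b \<partial>P) < exp (- (\<kappa> - m))"
      unfolding eventually_sequentially by (meson le_Suc_eq order_refl)
    then have "exp (\<kappa> - m) * (\<integral>\<omega>. l (\<theta> 1 \<omega>) ^ Suc b \<partial>P) < exp (\<kappa> - m) * exp (- (\<kappa> - m))"
      by (rule mult_strict_left_mono) simp
    then have less: "exp (\<kappa> - m) * (\<integral>\<omega>. l (\<theta> 1 \<omega>) ^ Suc b \<partial>P) < 1" (is "?R < 1")
      by (simp add: exp_add[symmetric] del: power_Suc)
    \<comment> \<open>The maximum with 1/2 keeps \<open>r\<close> positive even if the moment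
      vanishes, and \<open>less\<close> keeps it below 1.\<close>
    define r where "r = root (Suc b) (max ?R (1 / 2))"
    have "r ^ Suc b = max ?R (1 / 2)"
      unfolding r_def by (intro real_root_pow_pos2) auto
    moreover have "0 < r" "r < 1"
      using less by (auto simp: r_def simp del: power_Suc)
    ultimately show ?thesis
      using that[of r b] by simp
  qed

  \<comment> \<open>The weighted contraction estimate\<close>
  have bound: "(\<integral>W. G_weight (chain_law P f \<theta>) p x n (\<lambda>k. fst (W k)) * dist (fst (W n)) (snd (W n)) \<partial>Q (x, y))
      \<le> (1 + 1 / c) * r ^ n * dist x y" for x y n
  proof -
    let ?X = "\<lambda>\<omega> k. chain f \<theta> x k \<omega>"
    let ?L = "\<lambda>\<omega>. \<Prod>i\<in>{1..n}. l (\<theta> i \<omega>)"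
    define a where "a = Suc b"
    define e where "e = (\<integral>\<omega>. l (\<theta> 1 \<omega>) ^ a \<partial>P)"
    have D: "c * exp (- \<kappa> * real n) \<le> D x n" "0 < D x n"
      using assms(13)[of n x] assms(11)
      by (auto simp: D_def p_def intro: less_le_trans[OF mult_pos_pos[OF _ exp_gt_zero]])
    have DP: "D x n = (\<integral>\<omega>. penal p n (?X \<omega>) \<partial>P)"
      unfolding D_def chain_law_def by (subst integral_distr) auto
    have moment: "(\<integral>\<omega>. l (\<theta> i \<omega>) ^ a \<partial>P) = e" if "1 \<le> i" for i
    proof -
      have "(\<integral>\<omega>. l (\<theta> i \<omega>) ^ a \<partial>P) = (\<integral>t. l t ^ a \<partial>distr P M (\<theta> i))" if "1 \<le> i" for i
        using that by (subst integral_distr) auto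
      then show ?thesis
        unfolding e_def using that assms(8)[OF that] by simp
    qed
    have int_l: "integrable P (\<lambda>\<omega>. l (\<theta> i \<omega>) ^ a)" if "1 \<le> i" for i
      using that l0 l1[OF \<theta>_space]
      by (intro P.integrable_const_bound[where B=1]) (auto intro!: AE_I2 power_le_one)
    have indep_l: "P.indep_vars (\<lambda>_. borel) (\<lambda>i \<omega>. l (\<theta> i \<omega>) ^ a) {1..n}"
      by (rule P.indep_vars_subset[OF P.indep_vars_compose2[OF indep]]) auto
    have L_eq: "?L \<omega> ^ a = (\<Prod>i\<in>{1..n}. l (\<theta> i \<omega>) ^ a)" for \<omega>
      by (simp add: prod_power_distrib)
    have int_L: "integrable P (\<lambda>\<omega>. ?L \<omega> ^ a)"
      unfolding L_eq by (rule P.indep_vars_integrable[OF _ indep_l int_l]) auto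
    have E_L: "(\<integral>\<omega>. ?L \<omega> ^ a \<partial>P) = e ^ n"
      unfolding L_eq by (subst P.indep_vars_lebesgue_integral[OF _ indep_l int_l]) (auto simp: moment)
    have int_pen: "integrable P (\<lambda>\<omega>. penal p n (?X \<omega>))"
      using penal0 penal_le
      by (intro P.integrable_const_bound[where B="exp (- m * real n)"]) auto
    \<comment> \<open>The weight stays exact in the first term, where its integral cancels
      \<open>D x n\<close>. In the second it is replaced by a constant, since it may depend on
      \<open>?L\<close>; only the factors of \<open>?L\<close> are mutually independent.\<close>
    let ?U = "\<lambda>\<omega>. (penal p n (?X \<omega>) * r ^ n
        + exp (- m * real n) * (?L \<omega> ^ a / (r ^ n) ^ b)) * dist x y / D x n"
    have pointwise: "G_weight (chain_law P f \<theta>) p x n (?X \<omega>)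
        * dist (chain f \<theta> x n \<omega>) (chain f \<theta> y n \<omega>) \<le> ?U \<omega>"
      if \<omega>: "\<omega> \<in> space P" for \<omega>
    proof -
      have L0: "0 \<le> ?L \<omega>"
        by (auto intro: prod_nonneg l0)
      have "dist (chain f \<theta> x n \<omega>) (chain f \<theta> y n \<omega>) \<le> ?L \<omega> * dist x y"
        unfolding l_def by (intro dist_chain_le fin \<theta>_space \<omega>)
      also have "\<dots> \<le> (r ^ n + ?L \<omega> ^ a / (r ^ n) ^ b) * dist x y"
        unfolding a_def using r L0 by (intro mult_right_mono le_add_power_div) auto
      finally have "penal p n (?X \<omega>) * dist (chain f \<theta> x n \<omega>) (chain f \<theta> y n \<omega>)
          \<le> penal p n (?X \<omega>) * ((r ^ n + ?L \<omega> ^ a / (r ^ n) ^ b) * dist x y)"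
        by (rule mult_left_mono) (rule penal0)
      also have "\<dots> = (penal p n (?X \<omega>) * r ^ n + penal p n (?X \<omega>) * (?L \<omega> ^ a / (r ^ n) ^ b)) * dist x y"
        by (simp add: algebra_simps)
      also have "\<dots> \<le> (penal p n (?X \<omega>) * r ^ n + exp (- m * real n) * (?L \<omega> ^ a / (r ^ n) ^ b)) * dist x y"
        using r L0 by (intro mult_right_mono add_left_mono penal_le) auto
      finally show ?thesis
        unfolding G_weight_def D_def[symmetric] using D by (simp add: divide_right_mono)
    qed
    have [measurable]: "(\<lambda>w. dist (fst w) (snd w)) \<in> borel_measurable (borel :: ('a \<times> 'a) measure)"
      by (intro borel_measurable_continuous_onI continuous_intros)
    have "(\<lambda>W. penal p n (\<lambda>k. fst (W k))) \<in> borel_measurable path_space"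
      using measurable_compose[OF fst_path measurable_penal[of p n]] by simp
    then have integrand: "(\<lambda>W. G_weight (chain_law P f \<theta>) p x n (\<lambda>k. fst (W k)) * dist (fst (W n)) (snd (W n)))
        \<in> borel_measurable path_space"
      unfolding G_weight_def by measurable
    have "(\<integral>W. G_weight (chain_law P f \<theta>) p x n (\<lambda>k. fst (W k)) * dist (fst (W n)) (snd (W n)) \<partial>Q (x, y))
        = (\<integral>\<omega>. G_weight (chain_law P f \<theta>) p x n (?X \<omega>) * dist (chain f \<theta> x n \<omega>) (chain f \<theta> y n \<omega>) \<partial>P)"
      unfolding Q_def chain_law_def[of P "\<lambda>t. map_prod (f t) (f t)"]
      by (subst integral_distr[OF path2 integrand]) (simp add: chain_map_prod)
    also have "\<dots> \<le> (\<integral>\<omega>. ?U \<omega> \<partial>P)"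
    \<comment> \<open>A non-integrable left side would have integral 0 by default, which is why
      \<open>?U\<close> must be nonnegative.\<close>
    proof (rule integral_mono'[OF _ pointwise])
      show "integrable P ?U"
        using int_pen int_L by auto
      show "0 \<le> ?U \<omega>" for \<omega>
        using penal0 r l0 D by (intro divide_nonneg_nonneg mult_nonneg_nonneg add_nonneg_nonneg zero_le_power prod_nonneg) auto
    qed
    also have "\<dots> = (D x n * r ^ n + exp (- m * real n) * (e ^ n / (r ^ n) ^ b)) * dist x y / D x n"
      using int_pen int_L by (simp add: E_L DP del: One_nat_def)
    also have "\<dots> = (r ^ n + exp (- m * real n) * e ^ n / (r ^ n) ^ b / D x n) * dist x y"
      using D by (simp add: field_simps)
    also have "\<dots> \<le> (r ^ n + 1 / c * r ^ n) * dist x y"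
    proof (intro mult_right_mono add_left_mono)
      \<comment> \<open>Splitting off \<open>exp (- \<kappa> * real n)\<close> leaves the
        \<open>n\<close>-th power of the quantity bounded in \<open>rb\<close>.\<close>
      have "exp (- m * real n) * e ^ n = exp (- \<kappa> * real n) * (exp (\<kappa> - m) * e) ^ n"
        by (simp add: power_mult_distrib exp_of_nat_mult[symmetric] exp_add[symmetric] algebra_simps)
      also have "\<dots> \<le> exp (- \<kappa> * real n) * (r ^ a) ^ n"
        using rb l0 by (intro mult_left_mono power_mono)
          (auto simp: a_def e_def simp del: power_Suc intro!: mult_nonneg_nonneg Bochner_Integration.integral_nonneg)
      \<comment> \<open>As \<open>a = Suc b\<close>, exactly one factor \<open>r ^ n\<close>
        survives division by \<open>(r ^ n) ^ b\<close>.\<close>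
      also have "\<dots> = exp (- \<kappa> * real n) * r ^ n * (r ^ n) ^ b"
        by (simp add: a_def power_mult[symmetric] power_add[symmetric] algebra_simps)
      finally have "exp (- m * real n) * e ^ n / (r ^ n) ^ b \<le> exp (- \<kappa> * real n) * r ^ n"
        using r by (simp add: field_simps)
      \<comment> \<open>The lower bound on the mean weight turns
        \<open>exp (- \<kappa> * real n)\<close> into \<open>D x n / c\<close>; the normalization
        then cancels \<open>D x n\<close>.\<close>
      also have "\<dots> \<le> (D x n / c) * r ^ n"
        using D assms(11) r by (intro mult_right_mono) (auto simp: field_simps)
      finally show "exp (- m * real n) * e ^ n / (r ^ n) ^ b / D x n \<le> 1 / c * r ^ n"
        unfolding pos_divide_le_eq[OF D(2)] by (simp add: mult_ac)
    qed auto
    finally show ?thesis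
      by (simp add: algebra_simps)
  qed
  \<comment> \<open>The rate is \<open>- ln r\<close>, positive because \<open>0 < r < 1\<close>. In
    the constant \<open>1 + 1 / c\<close>, the 1 comes from the small error and \<open>1 / c\<close>
    from the high power.\<close>
  have "r ^ n = exp (- (- ln r) * real n)" for n
    using r by (simp add: exp_of_nat2_mult)
  then show ?thesis
    unfolding condition_A_def p_def[symmetric]
    using r assms(11) sets_Q coupling markov bound
    by (intro exI[of _ "1 + 1 / c"] conjI exI[of _ "- ln r"] exI[of _ Q]
        exI[of _ "\<lambda>x. distr (distr P M (\<theta> 1)) borel (\<lambda>t. map_prod (f t) (f t) x)"] allI)
       (auto simp: add_pos_pos)
qed

end
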